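(* Let $\gamma/\lambda$ be a skew shape with $n$ rows and $k$ columns. If $\mu=(\mu_1,\mu_2,\ldots)$ is a partition with $c^{\gamma}_{\lambda,\mu}\neq0$, then $$(\mu_1,\mu_2,\ldots)\le_{GDom}\partial^{(0)}(\gamma/\lambda),$$ and for all $1\le j\le n$ and all sequences $1\le i_1<\cdots<i_j\le n$, $$(\mu_{j+1},\mu_{j+2},\ldots)\le_{GDom}\partial^{(i_1,\ldots,i_j)}(\gamma/\lambda).$$ Moreover, for $\mu=\partial^{(0)}(\gamma/\lambda)$ one has $c^{\gamma}_{\lambda,\mu}=1$; that is, $\partial^{(0)}(\gamma/\lambda)$ is the maximum partition $\mu$ with $c^{\gamma}_{\lambda,\mu}\neq0$ with respect to the generalized dominance order.
   Context: For partitions $\lambda\subseteq\gamma$, where $\gamma=(\gamma_1,\ldots,\gamma_n)$ and $\lambda$ is padded by zeros to $(\lambda_1,\ldots,\lambda_n)$, the skew shape $\gamma/\lambda$ is the set of cells $(i,j)$ (row $i$ from the top, column $j$ from the left) with $\lambda_i<j\le\gamma_i$; it has $n$ rows. The top-left standardization ${}^\leftarrow\!\uparrow(\gamma/\lambda)$ is the transpose of the partition obtained by listing the column sizes of $\gamma/\lambda$ in non-increasing order; its $i$-th part is the number of columns with at least $i$ cells. For $1\le i_1<\cdots<i_j\le n$, $\gamma/\lambda^{(i_1,\ldots,i_j)}$ denotes the skew shape obtained by deleting rows $i_1,\ldots,i_j$ of $\gamma/\lambda$ and concatenating the remaining rows vertically (keeping their horizontal positions), i.e. $\tilde\gamma/\tilde\lambda$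 where $\tilde\gamma,\tilde\lambda$ are obtained from $(\gamma_1,\ldots,\gamma_n)$, $(\lambda_1,\ldots,\lambda_n)$ by deleting the entries in positions $i_1,\ldots,i_j$. Upper derivations: $\partial^{(0)}(\gamma/\lambda)={}^\leftarrow\!\uparrow(\gamma/\lambda)$ and $\partial^{(i_1,\ldots,i_j)}(\gamma/\lambda)={}^\leftarrow\!\uparrow(\gamma/\lambda^{(i_1,\ldots,i_j)})$. Generalized dominance order: for a partition $\alpha=(\alpha_1,\ldots,\alpha_k)$ of $n'$ and a partition $\beta=(\beta_1,\ldots,\beta_l)$ of $m'$ with $n'\le m'$, $\alpha\le_{GDom}\beta$ means $\alpha_1+\cdots+\alpha_i\le\beta_1+\cdots+\beta_i$ for all $1\le i\le\min\{k,l\}$. $c^{\gamma}_{\lambda,\mu}$ is the Littlewood–Richardson coefficient ($s_\lambda s_\mu=\sum_\gamma c^\gamma_{\lambda,\mu}s_\gamma$), equal to the number of Littlewood–Richardson tableaux of shape $\gamma/\lambda$ and content $\mu$, i.e. semi-standard tableaux of shape $\gamma/\lambda$ (rows weakly increasing left to right, columns strictly increasing downward) with $\mu_i$ labels equal to $i$, whose reverse row word (rows read right to left, top row first) is a lattice word (every prefix contains, for each $b\ge2$, at most as many $b$'s as $(b-1)$'s). *)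

theory Defs
  imports Main
begin

definition is_partition :: "nat list \<Rightarrow> bool" where
  "is_partition \<alpha> \<longleftrightarrow> sorted_wrt (\<ge>) \<alpha> \<and> (\<forall>a\<in>set \<alpha>. 0 < a)"

text \<open>Parts, rows, columns and tableau labels are all indexed from 1. A list is read as a
  sequence padded by zeros; so \<open>part \<alpha> i\<close> is the usual $\alpha_i$.\<close>

definition part :: "nat list \<Rightarrow> nat \<Rightarrow> nat" where
  "part \<alpha> i = (if 1 \<le> i \<and> i \<le> length \<alpha> then \<alpha> ! (i - 1) else 0)"

definition is_skew_shape :: "nat list \<Rightarrow> nat list \<Rightarrow> bool" where
  "is_skew_shape \<gamma> lam \<longleftrightarrow>
     is_partition \<gamma> \<and> is_partition lam \<and> (\<forall>i\<ge>1. part lam i \<le> part \<gamma> i)"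

definition skew_cells :: "nat list \<Rightarrow> nat list \<Rightarrow> (nat \<times> nat) set" where
  "skew_cells \<gamma> lam =
     {(i, j). 1 \<le> i \<and> i \<le> length \<gamma> \<and> part lam i < j \<and> j \<le> part \<gamma> i}"

definition conj_partition :: "nat list \<Rightarrow> nat list" where
  "conj_partition \<alpha> = map (\<lambda>i. length (filter (\<lambda>a. i \<le> a) \<alpha>)) [1..<Suc (part \<alpha> 1)]"

text \<open>Only the nonempty columns are listed, so all column sizes are positive.\<close>

definition column_sizes :: "nat list \<Rightarrow> nat list \<Rightarrow> nat list" where
  "column_sizes \<gamma> lam =
     rev (sort (map (\<lambda>j. card {i. (i, j) \<in> skew_cells \<gamma> lam})
                    (sorted_list_of_set (snd ` skew_cells \<gamma> lam))))"

definition top_left_std :: "nat list \<Rightarrow> nat list \<Rightarrow> nat list" where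
  "top_left_std \<gamma> lam = conj_partition (column_sizes \<gamma> lam)"

definition delete_positions :: "nat list \<Rightarrow> nat list \<Rightarrow> nat list" where
  "delete_positions is \<alpha> = nths \<alpha> {p. Suc p \<notin> set is}"

definition upper_deriv0 :: "nat list \<Rightarrow> nat list \<Rightarrow> nat list" where
  "upper_deriv0 \<gamma> lam = top_left_std \<gamma> lam"

text \<open>The inner partition has to be padded to the number of rows before entries are deleted.
  The padded inner list, and the list obtained from it by deletion, may end in zeros.\<close>

definition upper_deriv :: "nat list \<Rightarrow> nat list \<Rightarrow> nat list \<Rightarrow> nat list" where
  "upper_deriv is \<gamma> lam =
     top_left_std (delete_positions is \<gamma>)
       (delete_positions is (map (part lam) [1..<Suc (length \<gamma>)]))"

text \<open>The requirement that the size of \<open>\<alpha>\<close> is at most the size of \<open>\<beta>\<close> is part of the relation.\<close>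

definition gdom_le :: "nat list \<Rightarrow> nat list \<Rightarrow> bool"  (infix \<open>\<le>\<^sub>G\<close> 50) where
  "\<alpha> \<le>\<^sub>G \<beta> \<longleftrightarrow> sum_list \<alpha> \<le> sum_list \<beta> \<and>
     (\<forall>i. 1 \<le> i \<and> i \<le> min (length \<alpha>) (length \<beta>) \<longrightarrow>
        (\<Sum>t = 1..i. part \<alpha> t) \<le> (\<Sum>t = 1..i. part \<beta> t))"

text \<open>A tableau is a total function on cells. It takes positive values on the shape and, to make
  tableaux of a given shape countable, the value 0 outside the shape.\<close>

definition semistandard :: "nat list \<Rightarrow> nat list \<Rightarrow> (nat \<times> nat \<Rightarrow> nat) \<Rightarrow> bool" where
  "semistandard \<gamma> lam T \<longleftrightarrow>
     (\<forall>c. c \<notin> skew_cells \<gamma> lam \<longrightarrow> T c = 0) \<and>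
     (\<forall>c \<in> skew_cells \<gamma> lam. 1 \<le> T c) \<and>
     (\<forall>i j j'. (i, j) \<in> skew_cells \<gamma> lam \<and> (i, j') \<in> skew_cells \<gamma> lam \<and> j < j'
        \<longrightarrow> T (i, j) \<le> T (i, j')) \<and>
     (\<forall>i i' j. (i, j) \<in> skew_cells \<gamma> lam \<and> (i', j) \<in> skew_cells \<gamma> lam \<and> i < i'
        \<longrightarrow> T (i, j) < T (i', j))"

definition has_content :: "nat list \<Rightarrow> nat list \<Rightarrow> (nat \<times> nat \<Rightarrow> nat) \<Rightarrow> nat list \<Rightarrow> bool" where
  "has_content \<gamma> lam T \<mu> \<longleftrightarrow> (\<forall>b\<ge>1. card {c \<in> skew_cells \<gamma> lam. T c = b} = part \<mu> b)"

definition reverse_row_word :: "nat list \<Rightarrow> nat list \<Rightarrow> (nat \<times> nat \<Rightarrow> nat) \<Rightarrow> nat list" where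
  "reverse_row_word \<gamma> lam T =
     concat (map (\<lambda>i. rev (map (\<lambda>j. T (i, j)) [Suc (part lam i)..<Suc (part \<gamma> i)]))
                 [1..<Suc (length \<gamma>)])"

definition lattice_word :: "nat list \<Rightarrow> bool" where
  "lattice_word w \<longleftrightarrow>
     (\<forall>p b. 2 \<le> b \<longrightarrow> count_list (take p w) b \<le> count_list (take p w) (b - 1))"

definition lr_tableaux :: "nat list \<Rightarrow> nat list \<Rightarrow> nat list \<Rightarrow> (nat \<times> nat \<Rightarrow> nat) set" where
  "lr_tableaux \<gamma> lam \<mu> =
     {T. semistandard \<gamma> lam T \<and> has_content \<gamma> lam T \<mu> \<and> lattice_word (reverse_row_word \<gamma> lam T)}"

text \<open>The Littlewood--Richardson coefficient $c^\gamma_{\lambda,\mu}$ of a skew shape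
  $\gamma/\lambda$, taken as the number of Littlewood--Richardson tableaux. The set is finite
  because the content bounds the labels.\<close>

definition lr_coeff :: "nat list \<Rightarrow> nat list \<Rightarrow> nat list \<Rightarrow> nat" where
  "lr_coeff \<gamma> lam \<mu> = card (lr_tableaux \<gamma> lam \<mu>)"

end

theory Submission imports Defs begin

text \<open>Let \<open>T\<close> be a Littlewood--Richardson tableau of content \<open>\<mu>\<close>, let \<open>D\<close> be the set of deleted rows and let
  \<open>e s\<close> be the number of deleted rows among the first \<open>s\<close>. Since the columns of a skew shape are
  contiguous, \<open>T - e\<close> is still strictly increasing down the columns of the remaining rows, so at most
  \<open>min N k\<close> cells of a column with \<open>k\<close> remaining cells have \<open>1 \<le> T - e \<le> N\<close>. Reading the rows from the
  top, the lattice condition shows that altogether at least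
  \<open>\<mu>\<^sub>j\<^sub>+\<^sub>1 + \<dots> + \<mu>\<^sub>j\<^sub>+\<^sub>N\<close> remaining cells satisfy this, where \<open>j\<close> is the size of \<open>D\<close>.

  For the maximal content, the tableau numbering each column from the top is a
  Littlewood--Richardson tableau. Its labels are pointwise minimal among all semistandard tableaux,
  hence no other one has the same content.\<close>

section \<open>Partitions, skew shapes and their columns\<close>

definition col_size :: "nat list \<Rightarrow> nat list \<Rightarrow> nat \<Rightarrow> nat" where
  "col_size \<gamma> lam j = card {i. (i, j) \<in> skew_cells \<gamma> lam}"

lemma part_antimono:
  assumes "is_partition \<alpha>" "1 \<le> i" "i \<le> i'"
  shows "part \<alpha> i' \<le> part \<alpha> i"
proof (cases "i = i' \<or> length \<alpha> < i'")
  case True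
  then show ?thesis by (auto simp: part_def)
next
  case False
  have "sorted_wrt (\<ge>) \<alpha>" using assms(1) by (simp add: is_partition_def)
  then show ?thesis using False assms by (auto simp: part_def sorted_wrt_iff_nth_less)
qed

lemma sum_part:
  assumes "length \<alpha> \<le> N"
  shows "(\<Sum>t = 1..N. part \<alpha> t) = sum_list \<alpha>"
proof -
  have "(\<Sum>t = 1..N. part \<alpha> t) = (\<Sum>t\<in>{1..length \<alpha>}. part \<alpha> t)"
    using assms by (intro sum.mono_neutral_right) (auto simp: part_def)
  also have "\<dots> = (\<Sum>t\<in>{0..<length \<alpha>}. \<alpha> ! t)"
    by (rule sum.reindex_bij_witness[of _ Suc "\<lambda>t. t - 1"]) (auto simp: part_def)
  finally show ?thesis by (simp add: sum_list_sum_nth)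
qed

text \<open>Beyond both lengths the partial sums are the sizes, so the size condition of
  \<open>gdom_le\<close> is the case of a large \<open>N\<close>.\<close>

lemma gdom_leI:
  assumes "\<And>N. (\<Sum>t = 1..N. part \<alpha> t) \<le> (\<Sum>t = 1..N. part \<beta> t)"
  shows "\<alpha> \<le>\<^sub>G \<beta>"
proof -
  have "sum_list \<alpha> \<le> sum_list \<beta>"
    using assms[of "max (length \<alpha>) (length \<beta>)"]
    by (simp only: sum_part max.cobounded1 max.cobounded2)
  with assms show ?thesis by (simp only: gdom_le_def) blast
qed

lemma part_drop: "1 \<le> t \<Longrightarrow> part (drop j \<mu>) t = part \<mu> (j + t)"
  by (auto simp: part_def)

lemma finite_skew_cells [simp]: "finite (skew_cells \<gamma> lam)"
proof (rule finite_subset)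
  show "skew_cells \<gamma> lam \<subseteq> {1..length \<gamma>} \<times> {0..sum_list \<gamma>}"
    by (auto simp: skew_cells_def part_def intro!: order_trans[OF _ elem_le_sum_list[of "i - 1" \<gamma> for i]])
qed auto

lemma finite_skew_column [simp]: "finite {i. (i, j) \<in> skew_cells \<gamma> lam}"
  by (rule finite_subset[of _ "fst ` skew_cells \<gamma> lam"]) force+

lemma finite_skew_row [simp]: "finite {j. (i, j) \<in> skew_cells \<gamma> lam}"
  by (rule finite_subset[of _ "snd ` skew_cells \<gamma> lam"]) force+

text \<open>The outer bound at row \<open>x\<close> is inherited from the lower cell and the inner
  bound from the upper one, as both partitions decrease.\<close>

lemma skew_column_convex:
  assumes "is_skew_shape \<gamma> lam" "(s, j) \<in> skew_cells \<gamma> lam" "(s', j) \<in> skew_cells \<gamma> lam"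
    and "s \<le> x" "x \<le> s'"
  shows "(x, j) \<in> skew_cells \<gamma> lam"
  using assms part_antimono[of \<gamma> x s'] part_antimono[of lam s x]
  by (auto simp: is_skew_shape_def skew_cells_def)

section \<open>Conjugate partitions and column sizes\<close>

lemma part_conj_partition:
  assumes "sorted_wrt (\<ge>) \<alpha>" "1 \<le> b"
  shows "part (conj_partition \<alpha>) b = length (filter (\<lambda>a. b \<le> a) \<alpha>)"
proof (cases "b \<le> part \<alpha> 1")
  case True
  then have "[1..<Suc (part \<alpha> 1)] ! (b - 1) = b" using assms(2) by (subst nth_upt) auto
  with True show ?thesis
    using assms(2) by (simp add: conj_partition_def part_def[of "map _ _"] del: upt_Suc)
next
  case False
  \<comment> \<open>The first entry is the largest, so no entry reaches \<open>b\<close>; this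
    agrees with the padding zero of \<open>part\<close>.\<close>
  have "filter (\<lambda>a. b \<le> a) \<alpha> = []"
    using assms(1) False by (cases \<alpha>) (auto simp: part_def filter_empty_conv)
  with False show ?thesis by (simp add: conj_partition_def part_def[of "map _ _"] del: upt_Suc)
qed

text \<open>Raising the threshold loses entries, and the first entry of \<alpha> meets every
  threshold that is listed, so no part is 0.\<close>

lemma is_partition_conj_partition:
  assumes "sorted_wrt (\<ge>) \<alpha>"
  shows "is_partition (conj_partition \<alpha>)"
proof -
  let ?f = "\<lambda>i. length (filter (\<lambda>a. i \<le> a) \<alpha>)"
  have mono: "?f i' \<le> ?f i" if "i \<le> i'" for i i' :: nat
    using that by (auto simp: length_filter_conv_card intro!: card_mono)
  have pos: "0 < ?f i" if "1 \<le> i" "i \<le> part \<alpha> 1" for i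
    using that by (cases \<alpha>) (auto simp: part_def)
  show ?thesis
    unfolding is_partition_def conj_partition_def
    using mono pos by (auto simp: sorted_wrt_map sorted_wrt_iff_nth_less simp del: upt_Suc)
qed

lemma sorted_column_sizes: "sorted_wrt (\<ge>) (column_sizes \<gamma> lam)"
  by (simp add: column_sizes_def sorted_wrt_rev)

text \<open>Sorting does not change the count, and since \<open>b\<close> is positive the columns
  left out of the list, all of them empty, are not counted on the right either.\<close>

lemma part_top_left_std:
  assumes "1 \<le> b"
  shows "part (top_left_std \<gamma> lam) b = card {j. b \<le> col_size \<gamma> lam j}"
proof -
  let ?J = "snd ` skew_cells \<gamma> lam"
  let ?L = "sorted_list_of_set ?J"
  have "part (top_left_std \<gamma> lam) b = length (filter (\<lambda>a. b \<le> a) (column_sizes \<gamma> lam))"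
    unfolding top_left_std_def by (rule part_conj_partition[OF sorted_column_sizes assms])
  also have "\<dots> = length (filter (\<lambda>a. b \<le> a) (map (col_size \<gamma> lam) ?L))"
    unfolding column_sizes_def col_size_def by (simp only: rev_filter[symmetric] filter_sort length_rev length_sort)
  also have "\<dots> = card (set (filter (\<lambda>j. b \<le> col_size \<gamma> lam j) ?L))"
    by (subst distinct_card) (auto simp: filter_map comp_def)
  also have "set (filter (\<lambda>j. b \<le> col_size \<gamma> lam j) ?L) = {j. b \<le> col_size \<gamma> lam j}"
  proof -
    have "j \<in> ?J" if "b \<le> col_size \<gamma> lam j" for j
    proof -
      have "{i. (i, j) \<in> skew_cells \<gamma> lam} \<noteq> {}"
        using that assms unfolding col_size_def by (metis card.empty not_one_le_zero order_trans)
      then show ?thesis by force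
    qed
    then show ?thesis by auto
  qed
  finally show ?thesis .
qed

text \<open>Double counting: a column with \<open>k\<close> cells adds 1 to each of the parts 1 to
  \<open>k\<close>, hence \<open>min N k\<close> to the first \<open>N\<close> parts. The freedom in
  \<open>J\<close> allows summing over the columns of the original shape after rows have been
  deleted.\<close>

lemma sum_part_top_left_std:
  assumes "finite J" "snd ` skew_cells \<gamma> lam \<subseteq> J"
  shows "(\<Sum>t = 1..N. part (top_left_std \<gamma> lam) t) = (\<Sum>j\<in>J. min N (col_size \<gamma> lam j))"
proof -
  have zero: "col_size \<gamma> lam j = 0" if "j \<notin> J" for j
  proof -
    have "{i. (i, j) \<in> skew_cells \<gamma> lam} = {}" using that assms(2) by force
    then show ?thesis by (simp add: col_size_def)
  qed
  have "(\<Sum>t = 1..N. part (top_left_std \<gamma> lam) t) = (\<Sum>t = 1..N. card {j \<in> J. t \<le> col_size \<gamma> lam j})"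
  proof (intro sum.cong refl)
    fix t assume t: "t \<in> {1..N}"
    then have "{j. t \<le> col_size \<gamma> lam j} = {j \<in> J. t \<le> col_size \<gamma> lam j}" using zero by force
    then show "part (top_left_std \<gamma> lam) t = card {j \<in> J. t \<le> col_size \<gamma> lam j}"
      using t by (simp add: part_top_left_std)
  qed
  also have "\<dots> = (\<Sum>t = 1..N. \<Sum>j\<in>J. if t \<le> col_size \<gamma> lam j then 1 else 0)"
    using assms(1) by (simp add: sum.If_cases Int_def)
  also have "\<dots> = (\<Sum>j\<in>J. \<Sum>t = 1..N. if t \<le> col_size \<gamma> lam j then 1 else 0)"
    by (rule sum.swap)
  also have "\<dots> = (\<Sum>j\<in>J. card {t \<in> {1..N}. t \<le> col_size \<gamma> lam j})"
    by (simp add: sum.If_cases Int_def)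
  also have "\<dots> = (\<Sum>j\<in>J. card {1..min N (col_size \<gamma> lam j)})"
    by (intro sum.cong refl arg_cong[where f = card]) auto
  finally show ?thesis by simp
qed

section \<open>Column sizes after deleting rows\<close>

lemma delete_positions_map_upt:
  "delete_positions is (map f [1..<Suc n]) = map f (filter (\<lambda>s. s \<notin> set is) [1..<Suc n])"
proof -
  \<comment> \<open>The entry at position \<open>p\<close>, counted from 0, is \<open>Suc p\<close>,
    so deletion by position becomes deletion by value.\<close>
  have "nths [1..<Suc n] {p. Suc p \<notin> set is} = filter (\<lambda>s. s \<notin> set is) [1..<Suc n]"
  proof (induction n)
    case (Suc n)
    have "[1..<Suc (Suc n)] = [1..<Suc n] @ [Suc n]" by simp
    then show ?case using Suc by (simp add: nths_append del: upt_Suc)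
  qed simp
  then show ?thesis by (simp add: delete_positions_def nths_map del: upt_Suc)
qed

lemma list_eq_map_part: "\<alpha> = map (part \<alpha>) [1..<Suc (length \<alpha>)]"
  by (rule nth_equalityI) (auto simp: part_def simp del: upt_Suc)

text \<open>Concatenation keeps horizontal positions, so row \<open>k\<close> of the reduced shape
  is row \<open>rs ! (k - 1)\<close> of the original one. Later arguments can therefore stay inside
  the original shape.\<close>

lemma col_size_delete_positions:
  "col_size (delete_positions is \<gamma>) (delete_positions is (map (part lam) [1..<Suc (length \<gamma>)])) j
     = card {s. s \<notin> set is \<and> (s, j) \<in> skew_cells \<gamma> lam}"
proof -
  define rs where "rs = filter (\<lambda>s. s \<notin> set is) [1..<Suc (length \<gamma>)]"
  have g: "delete_positions is \<gamma> = map (part \<gamma>) rs"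
    using delete_positions_map_upt[of "is" "part \<gamma>" "length \<gamma>"]
    by (simp only: rs_def list_eq_map_part[symmetric])
  have l: "delete_positions is (map (part lam) [1..<Suc (length \<gamma>)]) = map (part lam) rs"
    by (simp only: rs_def delete_positions_map_upt)
  have dist: "distinct rs" by (simp add: rs_def del: upt_Suc)
  have set_rs: "set rs = {1..length \<gamma>} - set is" by (auto simp: rs_def simp del: upt_Suc)
  have "bij_betw (\<lambda>k. rs ! (k - 1)) {k. (k, j) \<in> skew_cells (map (part \<gamma>) rs) (map (part lam) rs)}
          {s. s \<notin> set is \<and> (s, j) \<in> skew_cells \<gamma> lam}"
  proof (rule bij_betw_imageI)
    show "inj_on (\<lambda>k. rs ! (k - 1)) {k. (k, j) \<in> skew_cells (map (part \<gamma>) rs) (map (part lam) rs)}"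
      using dist by (auto simp: inj_on_def skew_cells_def nth_eq_iff_index_eq)
    show "(\<lambda>k. rs ! (k - 1)) ` {k. (k, j) \<in> skew_cells (map (part \<gamma>) rs) (map (part lam) rs)}
            = {s. s \<notin> set is \<and> (s, j) \<in> skew_cells \<gamma> lam}" (is "?A = ?B")
    proof
      show "?A \<subseteq> ?B"
      proof
        fix s assume "s \<in> ?A"
        then obtain k where k: "1 \<le> k" "k \<le> length rs" "s = rs ! (k - 1)"
          "part (map (part lam) rs) k < j" "j \<le> part (map (part \<gamma>) rs) k"
          by (auto simp: skew_cells_def)
        have "s \<in> set rs" using k by simp
        then show "s \<in> ?B" using k set_rs by (auto simp: skew_cells_def part_def[of "map _ rs"])
      qed
      show "?B \<subseteq> ?A"
      proof
        fix s assume s: "s \<in> ?B"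
        then have "s \<in> set rs" by (auto simp: set_rs skew_cells_def)
        then obtain k where "k < length rs" "s = rs ! k" by (auto simp: in_set_conv_nth)
        then show "s \<in> ?A" using s
          by (intro image_eqI[of _ _ "Suc k"]) (auto simp: skew_cells_def part_def[of "map _ rs"])
      qed
    qed
  qed
  then show ?thesis unfolding g l col_size_def by (rule bij_betw_same_card)
qed

section \<open>Dominance\<close>

definition row_count :: "nat list \<Rightarrow> nat list \<Rightarrow> (nat \<times> nat \<Rightarrow> nat) \<Rightarrow> nat \<Rightarrow> nat \<Rightarrow> nat" where
  "row_count \<gamma> lam T s b = card {j. (s, j) \<in> skew_cells \<gamma> lam \<and> T (s, j) = b}"

lemma sum_row_count:
  assumes "has_content \<gamma> lam T \<mu>" "1 \<le> b"
  shows "(\<Sum>s\<in>{1..length \<gamma>}. row_count \<gamma> lam T s b) = part \<mu> b"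
proof -
  have "{c \<in> skew_cells \<gamma> lam. T c = b}
      = (SIGMA s:{1..length \<gamma>}. {j. (s, j) \<in> skew_cells \<gamma> lam \<and> T (s, j) = b})"
    by (auto simp: skew_cells_def)
  moreover have "card {c \<in> skew_cells \<gamma> lam. T c = b} = part \<mu> b"
    using assms by (simp add: has_content_def)
  ultimately show ?thesis by (simp add: row_count_def)
qed

text \<open>In a weakly decreasing list every occurrence of \<open>b\<close> lies in the initial run
  of entries that are at least \<open>b\<close>.\<close>

lemma count_list_takeWhile_ge:
  "sorted_wrt (\<ge>) xs \<Longrightarrow> count_list (takeWhile (\<lambda>x. (b::nat) \<le> x) xs) b = count_list xs b"
  by (induction xs) (auto simp: count_list_0_iff)

lemma count_list_row:
  assumes "1 \<le> s" "s \<le> length \<gamma>"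
  shows "count_list (rev (map (\<lambda>j. T (s, j)) [Suc (part lam s)..<Suc (part \<gamma> s)])) b
           = row_count \<gamma> lam T s b"
proof -
  let ?L = "[Suc (part lam s)..<Suc (part \<gamma> s)]"
  have "count_list (map (\<lambda>j. T (s, j)) ?L) b = length (filter (\<lambda>j. T (s, j) = b) ?L)"
    by (simp add: count_list_eq_length_filter filter_map comp_def eq_commute del: upt_Suc)
  also have "\<dots> = card (set (filter (\<lambda>j. T (s, j) = b) ?L))"
    by (rule distinct_card[symmetric]) (simp del: upt_Suc)
  also have "set (filter (\<lambda>j. T (s, j) = b) ?L) = {j. (s, j) \<in> skew_cells \<gamma> lam \<and> T (s, j) = b}"
    using assms by (auto simp: skew_cells_def simp del: upt_Suc)
  finally show ?thesis by (simp add: row_count_def del: upt_Suc)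
qed

text \<open>The prefix of the word used here consists of the rows above \<open>r\<close> followed by the labels
  exceeding \<open>b\<close> of row \<open>r\<close>.\<close>

lemma lattice_row_count:
  assumes ss: "semistandard \<gamma> lam T" and lw: "lattice_word (reverse_row_word \<gamma> lam T)"
    and r: "Suc r \<le> length \<gamma>" and b: "1 \<le> b"
  shows "(\<Sum>s\<in>{1..Suc r}. row_count \<gamma> lam T s (Suc b)) \<le> (\<Sum>s\<in>{1..r}. row_count \<gamma> lam T s b)"
proof -
  define W where "W s = rev (map (\<lambda>j. T (s, j)) [Suc (part lam s)..<Suc (part \<gamma> s)])" for s
  define V where "V = concat (map W [1..<Suc r])"
  \<comment> \<open>This run has all the labels \<open>Suc b\<close> of row \<open>Suc r\<close> but
    none of its labels \<open>b\<close>; hence the sum on the right ends one row earlier.\<close>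
  define X where "X = takeWhile (\<lambda>x. Suc b \<le> x) (W (Suc r))"
  have split: "[1..<Suc (length \<gamma>)] = [1..<Suc r] @ Suc r # [Suc (Suc r)..<Suc (length \<gamma>)]"
    using r upt_add_eq_append[of 1 "Suc r" "length \<gamma> - r"] by (simp add: upt_conv_Cons del: upt_Suc)
  have w: "reverse_row_word \<gamma> lam T
      = V @ W (Suc r) @ concat (map W [Suc (Suc r)..<Suc (length \<gamma>)])"
    unfolding reverse_row_word_def W_def[symmetric] split V_def by simp
  have WX: "W (Suc r) = X @ dropWhile (\<lambda>x. Suc b \<le> x) (W (Suc r))"
    by (simp add: X_def)
  have "take (length (V @ X)) (reverse_row_word \<gamma> lam T) = V @ X"
    unfolding w by (subst WX) simp
  then have le: "count_list (V @ X) (Suc b) \<le> count_list (V @ X) b"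
    using lw b unfolding lattice_word_def by (metis Suc_1 Suc_le_mono diff_Suc_1)
  have cV: "count_list V c = (\<Sum>s\<in>{1..r}. row_count \<gamma> lam T s c)" for c
    using r unfolding V_def
  proof (induction r)
    case (Suc r)
    then show ?case using count_list_row[of "Suc r" \<gamma> T lam c] by (simp add: W_def)
  qed simp
  have "sorted_wrt (\<ge>) (W (Suc r))"
    using ss r unfolding W_def semistandard_def
    by (auto simp: sorted_wrt_rev sorted_wrt_map skew_cells_def simp del: upt_Suc
        intro: sorted_wrt_mono_rel[OF _ sorted_wrt_upt])
  then have "count_list X (Suc b) = row_count \<gamma> lam T (Suc r) (Suc b)"
    using count_list_row[of "Suc r" \<gamma> T lam "Suc b"] r
    unfolding X_def W_def by (simp only: count_list_takeWhile_ge)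
  moreover have "count_list X b = 0"
    unfolding X_def by (auto simp: count_list_0_iff dest: set_takeWhileD)
  ultimately show ?thesis using le by (simp add: cV)
qed

section \<open>Labels in a window that moves with the deleted rows\<close>

lemma semistandard_column_gap:
  assumes "is_skew_shape \<gamma> lam" "semistandard \<gamma> lam T"
    and "(s, j) \<in> skew_cells \<gamma> lam" "(s + k, j) \<in> skew_cells \<gamma> lam"
  shows "T (s, j) + k \<le> T (s + k, j)"
  using assms(4)
proof (induction k)
  case (Suc k)
  \<comment> \<open>Convexity of the column provides the intermediate cell, so the label grows by at
    least 1 at each step down.\<close>
  have "(s + k, j) \<in> skew_cells \<gamma> lam"
    using skew_column_convex[OF assms(1,3) Suc.prems] by simp
  moreover from this have "T (s + k, j) < T (s + Suc k, j)"
    using assms(2) Suc.prems unfolding semistandard_def by (metis add_Suc_right lessI)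
  ultimately show ?case using Suc.IH by simp
qed simp

text \<open>Between two remaining cells of the column the label grows by at least their distance,
  whereas \<open>e\<close> counts only the deleted rows strictly between them and grows by less.
  Hence \<open>T - e\<close> is injective on the window, with values in
  \<open>{1..N}\<close>.\<close>

lemma window_column_le:
  assumes sk: "is_skew_shape \<gamma> lam" and ss: "semistandard \<gamma> lam T" and D: "finite D"
  defines "e \<equiv> \<lambda>s. card (D \<inter> {1..s})"
  shows "card {s. s \<notin> D \<and> (s, j) \<in> skew_cells \<gamma> lam \<and> e s < T (s, j) \<and> T (s, j) \<le> e s + N}
           \<le> min N (card {s. s \<notin> D \<and> (s, j) \<in> skew_cells \<gamma> lam})" (is "card ?A \<le> min N (card ?B)")
proof -
  have finB: "finite ?B" by (rule finite_subset[OF _ finite_skew_column[of j \<gamma> lam]]) auto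
  have less: "T (s, j) - e s < T (s', j) - e s'" if "s \<in> ?A" "s' \<in> ?A" "s < s'" for s s'
  proof -
    \<comment> \<open>Row \<open>s'\<close> is a remaining row, so the interval of possible new
      deleted rows is open at \<open>s'\<close>; this saves the 1 needed for strictness.\<close>
    have "D \<inter> {1..s'} \<subseteq> (D \<inter> {1..s}) \<union> {s<..<s'}"
      using that by (auto simp: not_less le_less)
    then have "e s' \<le> card ((D \<inter> {1..s}) \<union> {s<..<s'})"
      unfolding e_def using D by (intro card_mono) auto
    also have "\<dots> \<le> e s + card {s<..<s'}" unfolding e_def by (rule card_Un_le)
    finally have "e s' \<le> e s + (s' - Suc s)" by simp
    moreover have "T (s, j) + (s' - s) \<le> T (s', j)"
      using semistandard_column_gap[OF sk ss, of s j "s' - s"] that by auto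
    ultimately show ?thesis using that by auto
  qed
  have "inj_on (\<lambda>s. T (s, j) - e s) ?A"
  proof (rule inj_onI)
    fix s s' assume "s \<in> ?A" "s' \<in> ?A" "T (s, j) - e s = T (s', j) - e s'"
    then show "s = s'" using less[of s s'] less[of s' s]
      by (cases s s' rule: linorder_cases) simp_all
  qed
  moreover have "(\<lambda>s. T (s, j) - e s) ` ?A \<subseteq> {1..N}" by auto
  ultimately have "card ?A \<le> card {1..N}" by (rule card_inj_on_le) simp
  moreover have "card ?A \<le> card ?B" using finB by (rule card_mono) auto
  ultimately show ?thesis by simp
qed

text \<open>Crossing a deleted row shifts the window of labels by one, and the lattice condition pays
  for the shift.\<close>

lemma window_rows_ge:
  assumes ss: "semistandard \<gamma> lam T" and lw: "lattice_word (reverse_row_word \<gamma> lam T)"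
    and D: "finite D"
  defines "e \<equiv> \<lambda>s. card (D \<inter> {1..s})"
  assumes "r \<le> length \<gamma>"
  shows "(\<Sum>b = 1..N. \<Sum>s\<in>{1..r}. row_count \<gamma> lam T s (e r + b))
           \<le> (\<Sum>s\<in>{1..r} - D. \<Sum>b = 1..N. row_count \<gamma> lam T s (e s + b))"
  using assms(5)
proof (induction r)
  case (Suc r)
  show ?case
  proof (cases "Suc r \<in> D")
    case True
    then have "D \<inter> {1..Suc r} = insert (Suc r) (D \<inter> {1..r})" by (auto simp: le_Suc_eq)
    then have e: "e (Suc r) = Suc (e r)" using D by (simp add: e_def)
    have "{1..Suc r} - D = {1..r} - D" using True by (auto simp: le_Suc_eq)
    \<comment> \<open>The lattice condition at label \<open>e r + b\<close>, for each
      \<open>b\<close>, lowers the labels by 1 and at the same time drops row \<open>Suc r\<close>,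
      which the right side lacks.\<close>
    moreover have "(\<Sum>b = 1..N. \<Sum>s\<in>{1..Suc r}. row_count \<gamma> lam T s (e (Suc r) + b))
        \<le> (\<Sum>b = 1..N. \<Sum>s\<in>{1..r}. row_count \<gamma> lam T s (e r + b))"
      using Suc.prems by (intro sum_mono) (auto simp only: e add_Suc atLeastAtMost_iff
          intro!: lattice_row_count[OF ss lw])
    ultimately show ?thesis using Suc by simp
  next
    case False
    then have "D \<inter> {1..Suc r} = D \<inter> {1..r}" by (auto simp: le_Suc_eq)
    then have e: "e (Suc r) = e r" by (simp add: e_def)
    have "{1..Suc r} - D = insert (Suc r) ({1..r} - D)" using False by (auto simp: le_Suc_eq)
    then show ?thesis using Suc by (simp add: e sum.distrib)
  qed
qed simp

text \<open>Double counting of the cells \<open>A\<close> in the moving window: by rows there are at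
  least as many as the left side says (\<open>window_rows_ge\<close>), by columns at most as many as
  the right side says (\<open>window_column_le\<close>).\<close>

lemma window_bound:
  assumes sk: "is_skew_shape \<gamma> lam" and ss: "semistandard \<gamma> lam T"
    and lw: "lattice_word (reverse_row_word \<gamma> lam T)" and hc: "has_content \<gamma> lam T \<mu>"
    and D: "D \<subseteq> {1..length \<gamma>}"
  shows "(\<Sum>t = 1..N. part \<mu> (card D + t))
           \<le> (\<Sum>j\<in>snd ` skew_cells \<gamma> lam. min N (card {s. s \<notin> D \<and> (s, j) \<in> skew_cells \<gamma> lam}))"
proof -
  define e where "e s = card (D \<inter> {1..s})" for s
  define A where "A = {(s, j) \<in> skew_cells \<gamma> lam. s \<notin> D \<and> e s < T (s, j) \<and> T (s, j) \<le> e s + N}"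
  have finD: "finite D" using D finite_subset by blast
  \<comment> \<open>At the last row all of \<open>D\<close> has been passed, so the window there
    starts just above \<open>card D\<close>.\<close>
  have eD: "e (length \<gamma>) = card D" using D by (simp add: e_def Int_absorb2)
  have finA: "finite A" by (rule finite_subset[OF _ finite_skew_cells[of \<gamma> lam]]) (auto simp: A_def)
  have row: "(\<Sum>b = 1..N. row_count \<gamma> lam T s (e s + b)) = card {j. (s, j) \<in> A}" if "s \<notin> D" for s
  proof -
    have "{j. (s, j) \<in> A} = (\<Union>b\<in>{1..N}. {j. (s, j) \<in> skew_cells \<gamma> lam \<and> T (s, j) = e s + b})"
    proof (intro equalityI subsetI)
      fix j assume "j \<in> {j. (s, j) \<in> A}"
      then show "j \<in> (\<Union>b\<in>{1..N}. {j. (s, j) \<in> skew_cells \<gamma> lam \<and> T (s, j) = e s + b})"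
        by (intro UN_I[of "T (s, j) - e s"]) (auto simp: A_def)
    qed (use that in \<open>auto simp: A_def\<close>)
    also have "card \<dots> = (\<Sum>b = 1..N. row_count \<gamma> lam T s (e s + b))"
      unfolding row_count_def
      by (intro card_UN_disjoint) (auto intro: finite_subset[OF _ finite_skew_row[of s \<gamma> lam]])
    finally show ?thesis by simp
  qed
  have "(\<Sum>t = 1..N. part \<mu> (card D + t))
      = (\<Sum>t = 1..N. \<Sum>s\<in>{1..length \<gamma>}. row_count \<gamma> lam T s (e (length \<gamma>) + t))"
    unfolding eD using D by (intro sum.cong refl sum_row_count[OF hc, symmetric]) simp
  also have "\<dots> \<le> (\<Sum>s\<in>{1..length \<gamma>} - D. \<Sum>b = 1..N. row_count \<gamma> lam T s (e s + b))"
    using window_rows_ge[OF ss lw finD order_refl] by (simp add: e_def)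
  also have "\<dots> = (\<Sum>s\<in>{1..length \<gamma>} - D. card {j. (s, j) \<in> A})"
    using row by simp
  also have "\<dots> = card (SIGMA s:{1..length \<gamma>} - D. {j. (s, j) \<in> A})"
    by (subst card_SigmaI)
      (auto simp: A_def intro: finite_subset[OF _ finite_skew_row[of _ \<gamma> lam]])
  also have "(SIGMA s:{1..length \<gamma>} - D. {j. (s, j) \<in> A}) = A"
    by (auto simp: A_def skew_cells_def)
  \<comment> \<open>From here on the same cells are grouped by columns.\<close>
  also have "A = (\<Union>j\<in>snd ` skew_cells \<gamma> lam. {c \<in> A. snd c = j})"
    by (force simp: A_def)
  also have "card \<dots> = (\<Sum>j\<in>snd ` skew_cells \<gamma> lam. card {c \<in> A. snd c = j})"
    using finA by (intro card_UN_disjoint) auto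
  also have "\<dots> \<le> (\<Sum>j\<in>snd ` skew_cells \<gamma> lam. min N (card {s. s \<notin> D \<and> (s, j) \<in> skew_cells \<gamma> lam}))"
  proof (rule sum_mono)
    fix j
    have "{c \<in> A. snd c = j} = (\<lambda>s. (s, j)) ` {s. s \<notin> D \<and> (s, j) \<in> skew_cells \<gamma> lam
        \<and> e s < T (s, j) \<and> T (s, j) \<le> e s + N}"
      by (auto simp: A_def)
    then show "card {c \<in> A. snd c = j} \<le> min N (card {s. s \<notin> D \<and> (s, j) \<in> skew_cells \<gamma> lam})"
      using window_column_le[OF sk ss finD, of j N]
      by (simp add: card_image inj_on_def e_def)
  qed
  finally show ?thesis .
qed

section \<open>The dominance inequalities\<close>

lemma lr_coeff_nonzeroE:
  assumes "lr_coeff \<gamma> lam \<mu> \<noteq> 0"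
  obtains T where "semistandard \<gamma> lam T" "has_content \<gamma> lam T \<mu>"
    "lattice_word (reverse_row_word \<gamma> lam T)"
proof -
  have "lr_tableaux \<gamma> lam \<mu> \<noteq> {}" using assms by (auto simp: lr_coeff_def)
  then show ?thesis using that by (auto simp: lr_tableaux_def)
qed

lemma lr_gdom_le_upper_deriv0:
  assumes "is_skew_shape \<gamma> lam" "lr_coeff \<gamma> lam \<mu> \<noteq> 0"
  shows "\<mu> \<le>\<^sub>G upper_deriv0 \<gamma> lam"
proof (rule gdom_leI)
  fix N
  obtain T where T: "semistandard \<gamma> lam T" "has_content \<gamma> lam T \<mu>"
    "lattice_word (reverse_row_word \<gamma> lam T)" using assms(2) by (rule lr_coeff_nonzeroE)
  \<comment> \<open>Without deleted rows the window is the fixed range of labels from 1 to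
    \<open>N\<close>.\<close>
  show "(\<Sum>t = 1..N. part \<mu> t) \<le> (\<Sum>t = 1..N. part (upper_deriv0 \<gamma> lam) t)"
    using window_bound[OF assms(1) T(1,3,2), of "{}" N]
    unfolding upper_deriv0_def
    by (subst sum_part_top_left_std[of "snd ` skew_cells \<gamma> lam"]) (simp_all add: col_size_def)
qed

lemma lr_gdom_le_upper_deriv:
  assumes "is_skew_shape \<gamma> lam" "lr_coeff \<gamma> lam \<mu> \<noteq> 0"
    and "set is \<subseteq> {1..length \<gamma>}" "distinct is"
  shows "drop (length is) \<mu> \<le>\<^sub>G upper_deriv is \<gamma> lam"
proof (rule gdom_leI)
  fix N
  obtain T where T: "semistandard \<gamma> lam T" "has_content \<gamma> lam T \<mu>"
    "lattice_word (reverse_row_word \<gamma> lam T)" using assms(2) by (rule lr_coeff_nonzeroE)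
  let ?g = "delete_positions is \<gamma>"
  let ?l = "delete_positions is (map (part lam) [1..<Suc (length \<gamma>)])"
  \<comment> \<open>Deleting rows creates no new nonempty columns, so the columns of the original
    shape can index the sum for the reduced one.\<close>
  have sub: "snd ` skew_cells ?g ?l \<subseteq> snd ` skew_cells \<gamma> lam"
  proof
    fix j assume "j \<in> snd ` skew_cells ?g ?l"
    then have "col_size ?g ?l j \<noteq> 0" by (auto simp: col_size_def)
    then have "{s. s \<notin> set is \<and> (s, j) \<in> skew_cells \<gamma> lam} \<noteq> {}"
      unfolding col_size_delete_positions by (metis card.empty)
    then show "j \<in> snd ` skew_cells \<gamma> lam" by force
  qed
  have "(\<Sum>t = 1..N. part (drop (length is) \<mu>) t) = (\<Sum>t = 1..N. part \<mu> (card (set is) + t))"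
    using assms(4) by (simp add: part_drop distinct_card)
  also have "\<dots> \<le> (\<Sum>j\<in>snd ` skew_cells \<gamma> lam. min N (col_size ?g ?l j))"
    using window_bound[OF assms(1) T(1,3,2) assms(3)] by (simp only: col_size_delete_positions)
  also have "\<dots> = (\<Sum>t = 1..N. part (upper_deriv is \<gamma> lam) t)"
    unfolding upper_deriv_def using sub by (subst sum_part_top_left_std) auto
  finally show "(\<Sum>t = 1..N. part (drop (length is) \<mu>) t) \<le> (\<Sum>t = 1..N. part (upper_deriv is \<gamma> lam) t)" .
qed

section \<open>The tableau of maximal content\<close>

text \<open>The tableau of maximal content: each column is numbered 1, 2, ... from the top. The
  value 0 elsewhere is the one that \<open>semistandard\<close> prescribes.\<close>

definition column_rank :: "nat list \<Rightarrow> nat list \<Rightarrow> nat \<times> nat \<Rightarrow> nat" where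
  "column_rank \<gamma> lam c = (if c \<in> skew_cells \<gamma> lam
     then card {i. i \<le> fst c \<and> (i, snd c) \<in> skew_cells \<gamma> lam} else 0)"

lemma finite_column_prefix [simp]: "finite {i. i \<le> r \<and> (i, j) \<in> skew_cells \<gamma> lam}"
  by (rule finite_subset[of _ "{..r}"]) auto

lemma column_rank_less:
  assumes "(i, j) \<in> skew_cells \<gamma> lam" "(i', j) \<in> skew_cells \<gamma> lam" "i < i'"
  shows "column_rank \<gamma> lam (i, j) < column_rank \<gamma> lam (i', j)"
proof -
  have "i' \<in> {x. x \<le> i' \<and> (x, j) \<in> skew_cells \<gamma> lam} - {x. x \<le> i \<and> (x, j) \<in> skew_cells \<gamma> lam}"
    using assms by simp
  then have "{x. x \<le> i \<and> (x, j) \<in> skew_cells \<gamma> lam} \<subset> {x. x \<le> i' \<and> (x, j) \<in> skew_cells \<gamma> lam}"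
    using assms(3) by fastforce
  then have "card {x. x \<le> i \<and> (x, j) \<in> skew_cells \<gamma> lam} < card {x. x \<le> i' \<and> (x, j) \<in> skew_cells \<gamma> lam}"
    by (intro psubset_card_mono) simp_all
  then show ?thesis using assms by (simp add: column_rank_def)
qed

lemma semistandard_column_rank:
  assumes "is_skew_shape \<gamma> lam"
  shows "semistandard \<gamma> lam (column_rank \<gamma> lam)"
  unfolding semistandard_def
proof (intro conjI allI impI ballI; (elim conjE)?)
  fix c assume "c \<in> skew_cells \<gamma> lam"
  then have "{i. i \<le> fst c \<and> (i, snd c) \<in> skew_cells \<gamma> lam} \<noteq> {}"
    by (cases c) auto
  then show "1 \<le> column_rank \<gamma> lam c"
    using \<open>c \<in> _\<close> by (simp add: column_rank_def Suc_le_eq card_gt_0_iff)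
next
  fix i j j' assume ij: "(i, j) \<in> skew_cells \<gamma> lam" "(i, j') \<in> skew_cells \<gamma> lam" "j < j'"
  \<comment> \<open>The cell exists because \<open>part lam x < j < j'\<close> and
    \<open>j' \<le> part \<gamma> i \<le> part \<gamma> x\<close>. So column \<open>j'\<close> has
    at least as many cells down to row \<open>i\<close> as column \<open>j\<close>.\<close>
  have "(x, j') \<in> skew_cells \<gamma> lam" if "x \<le> i" "(x, j) \<in> skew_cells \<gamma> lam" for x
    using that ij assms part_antimono[of \<gamma> x i] by (auto simp: skew_cells_def is_skew_shape_def)
  then show "column_rank \<gamma> lam (i, j) \<le> column_rank \<gamma> lam (i, j')"
    using ij by (auto simp: column_rank_def intro!: card_mono)
next
  fix i i' j
  assume "(i, j) \<in> skew_cells \<gamma> lam" "(i', j) \<in> skew_cells \<gamma> lam" "i < i'"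
  then show "column_rank \<gamma> lam (i, j) < column_rank \<gamma> lam (i', j)" by (rule column_rank_less)
qed (simp add: column_rank_def)

text \<open>A column with \<open>k\<close> cells carries each of the labels 1 to \<open>k\<close>
  exactly once, so label \<open>b\<close> occurs once in every column with at least \<open>b\<close>
  cells; the conjugate partition counts these columns.\<close>

lemma has_content_column_rank:
  "has_content \<gamma> lam (column_rank \<gamma> lam) (top_left_std \<gamma> lam)"
  unfolding has_content_def
proof (intro allI impI)
  fix b :: nat assume b: "1 \<le> b"
  let ?A = "{c \<in> skew_cells \<gamma> lam. column_rank \<gamma> lam c = b}"
  have img: "(\<lambda>i. column_rank \<gamma> lam (i, j)) ` {i. (i, j) \<in> skew_cells \<gamma> lam} = {1..col_size \<gamma> lam j}" for j
  proof (rule card_subset_eq)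
    have "inj_on (\<lambda>i. column_rank \<gamma> lam (i, j)) {i. (i, j) \<in> skew_cells \<gamma> lam}"
      by (rule inj_onI) (metis column_rank_less less_irrefl mem_Collect_eq nat_neq_iff)
    then show "card ((\<lambda>i. column_rank \<gamma> lam (i, j)) ` {i. (i, j) \<in> skew_cells \<gamma> lam})
        = card {1..col_size \<gamma> lam j}"
      by (simp add: card_image col_size_def)
    show "(\<lambda>i. column_rank \<gamma> lam (i, j)) ` {i. (i, j) \<in> skew_cells \<gamma> lam} \<subseteq> {1..col_size \<gamma> lam j}"
      by (auto simp: column_rank_def col_size_def Suc_le_eq card_gt_0_iff intro!: card_mono)
  qed simp
  have "snd ` ?A = {j. b \<le> col_size \<gamma> lam j}"
  proof -
    have "j \<in> snd ` ?A \<longleftrightarrow> b \<in> (\<lambda>i. column_rank \<gamma> lam (i, j)) ` {i. (i, j) \<in> skew_cells \<gamma> lam}" for j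
      by (force simp: image_iff)
    then show ?thesis unfolding img using b by auto
  qed
  moreover have "inj_on snd ?A"
    by (rule inj_onI) (auto, metis column_rank_less less_irrefl nat_neq_iff)
  ultimately have "card ?A = card {j. b \<le> col_size \<gamma> lam j}" by (metis card_image)
  then show "card ?A = part (top_left_std \<gamma> lam) b" by (simp add: part_top_left_std[OF b])
qed

text \<open>Each entry \<open>b + 1\<close> has an entry \<open>b\<close> directly above it, which is read earlier.\<close>

lemma lattice_word_column_rank:
  assumes sk: "is_skew_shape \<gamma> lam"
  shows "lattice_word (reverse_row_word \<gamma> lam (column_rank \<gamma> lam))"
  unfolding lattice_word_def
proof (intro allI impI)
  fix p b :: nat assume b: "2 \<le> b"
  let ?R = "column_rank \<gamma> lam"
  \<comment> \<open>Keeping cells instead of labels turns a prefix of the word into a set of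
    distinct cells, so that labels can be counted as cells.\<close>
  define row where "row i = rev (map (Pair i) [Suc (part lam i)..<Suc (part \<gamma> i)])" for i
  define L where "L = concat (map row [1..<Suc (length \<gamma>)])"
  have w: "reverse_row_word \<gamma> lam ?R = map ?R L"
    by (simp add: reverse_row_word_def L_def row_def map_concat comp_def rev_map[symmetric] del: upt_Suc)
  have setL: "set L = skew_cells \<gamma> lam"
    by (force simp: L_def row_def skew_cells_def simp del: upt_Suc)
  have L_aux: "distinct (concat (map row [1..<Suc m])) \<and> sorted (map fst (concat (map row [1..<Suc m])))" for m
  proof (induction m)
    case (Suc m)
    have "distinct (row (Suc m))" by (simp add: row_def distinct_map inj_on_def del: upt_Suc)
    moreover have "sorted (map fst (row (Suc m)))"
      by (simp add: row_def rev_map comp_def map_replicate_const del: upt_Suc)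
    ultimately show ?case using Suc by (auto simp: row_def sorted_append)
  qed simp
  have distL: "distinct L" and sortL: "sorted (map fst L)"
    using L_aux by (auto simp only: L_def)
  let ?S = "set (take p L)"
  have count: "count_list (take p (map ?R L)) a = card {c \<in> ?S. ?R c = a}" for a
  proof -
    have "count_list (take p (map ?R L)) a = length (filter (\<lambda>c. ?R c = a) (take p L))"
      by (simp add: count_list_eq_length_filter take_map filter_map comp_def eq_commute)
    also have "\<dots> = card (set (filter (\<lambda>c. ?R c = a) (take p L)))"
      using distL by (intro distinct_card[symmetric]) simp
    finally show ?thesis by simp
  qed
  \<comment> \<open>Rows are read in order: a cell outside the prefix lies in the rest of
    \<open>L\<close>, whose row indices are at least those of the prefix.\<close>
  have up: "c' \<in> ?S" if "c \<in> ?S" "c' \<in> skew_cells \<gamma> lam" "fst c' < fst c" for c c'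
  proof (rule ccontr)
    assume "c' \<notin> ?S"
    moreover have "c' \<in> set (take p L @ drop p L)" using that(2) unfolding append_take_drop_id setL .
    ultimately have "c' \<in> set (drop p L)" unfolding set_append by blast
    moreover have "sorted (map fst (take p L) @ map fst (drop p L))"
      using sortL by (metis append_take_drop_id map_append)
    ultimately have "fst c \<le> fst c'" using that(1) by (auto simp: sorted_append)
    with that(3) show False by simp
  qed
  have above: "(i - 1, j) \<in> skew_cells \<gamma> lam \<and> ?R (i - 1, j) = b - 1 \<and> 1 \<le> i"
    if "(i, j) \<in> skew_cells \<gamma> lam" "?R (i, j) = b" for i j
  proof -
    have c: "card {x. x \<le> i \<and> (x, j) \<in> skew_cells \<gamma> lam} = b"
      using that by (simp add: column_rank_def)
    have i: "1 \<le> i" using that by (simp add: skew_cells_def)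
    have eq: "{x. x \<le> i \<and> (x, j) \<in> skew_cells \<gamma> lam}
        = insert i {x. x \<le> i - 1 \<and> (x, j) \<in> skew_cells \<gamma> lam}" using that i by auto
    have c1: "card {x. x \<le> i - 1 \<and> (x, j) \<in> skew_cells \<gamma> lam} = b - 1"
      using c i unfolding eq by (subst (asm) card_insert_disjoint) auto
    \<comment> \<open>As \<open>b\<close> is at least 2, some cell lies above; convexity then yields
      the one in row \<open>i - 1\<close>.\<close>
    have "{x. x \<le> i - 1 \<and> (x, j) \<in> skew_cells \<gamma> lam} \<noteq> {}"
    proof
      assume empty: "{x. x \<le> i - 1 \<and> (x, j) \<in> skew_cells \<gamma> lam} = {}"
      show False using c1 b unfolding empty by simp
    qed
    then obtain x where "x \<le> i - 1" "(x, j) \<in> skew_cells \<gamma> lam" by auto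
    then have "(i - 1, j) \<in> skew_cells \<gamma> lam"
      using skew_column_convex[OF sk _ that(1)] by auto
    then show ?thesis using c1 i by (simp add: column_rank_def)
  qed
  have "card {c \<in> ?S. ?R c = b} \<le> card {c \<in> ?S. ?R c = b - 1}"
  proof (rule card_inj_on_le)
    let ?f = "\<lambda>(i, j). (i - 1 :: nat, j :: nat)"
    have S: "?S \<subseteq> skew_cells \<gamma> lam" using set_take_subset[of p L] setL by simp
    show "inj_on ?f {c \<in> ?S. ?R c = b}"
    proof (rule inj_onI)
      fix c c' assume c: "c \<in> {c \<in> ?S. ?R c = b}" "c' \<in> {c \<in> ?S. ?R c = b}" "?f c = ?f c'"
      \<comment> \<open>Rows are numbered from 1, so the truncated \<open>i - 1\<close> loses no
        information.\<close>
      then have "1 \<le> fst c" "1 \<le> fst c'" using S above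
        by (auto simp: skew_cells_def)
      then show "c = c'" using c(3) by (auto simp: case_prod_beta prod_eq_iff)
    qed
    show "?f ` {c \<in> ?S. ?R c = b} \<subseteq> {c \<in> ?S. ?R c = b - 1}"
    proof
      fix c' assume "c' \<in> ?f ` {c \<in> ?S. ?R c = b}"
      then obtain i j where c: "(i, j) \<in> ?S" "?R (i, j) = b" "c' = (i - 1, j)" by auto
      then have "(i, j) \<in> skew_cells \<gamma> lam" using S by auto
      from above[OF this c(2)] up[OF c(1), of "(i - 1, j)"]
      show "c' \<in> {c \<in> ?S. ?R c = b - 1}" using c(3) by simp
    qed
  qed simp
  then show "count_list (take p (reverse_row_word \<gamma> lam ?R)) b
      \<le> count_list (take p (reverse_row_word \<gamma> lam ?R)) (b - 1)"
    unfolding w count .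
qed

section \<open>Minimality of the column numbering and uniqueness\<close>

lemma column_rank_le:
  assumes ss: "semistandard \<gamma> lam T" and c: "c \<in> skew_cells \<gamma> lam"
  shows "column_rank \<gamma> lam c \<le> T c"
proof -
  obtain i j where ij: "c = (i, j)" by (cases c)
  let ?A = "{x. x \<le> i \<and> (x, j) \<in> skew_cells \<gamma> lam}"
  have less: "T (x, j) < T (x', j)"
    if "(x, j) \<in> skew_cells \<gamma> lam" "(x', j) \<in> skew_cells \<gamma> lam" "x < x'" for x x'
    using ss that unfolding semistandard_def by blast
  \<comment> \<open>The labels weakly above \<open>c\<close> in its column are distinct and lie
    between 1 and \<open>T c\<close>; the rank is their number.\<close>
  have "inj_on (\<lambda>x. T (x, j)) ?A"
    by (rule inj_onI) (metis (no_types, lifting) less less_irrefl mem_Collect_eq nat_neq_iff)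
  moreover have "(\<lambda>x. T (x, j)) ` ?A \<subseteq> {1..T c}"
  proof clarsimp
    fix x assume x: "x \<le> i" "(x, j) \<in> skew_cells \<gamma> lam"
    then have "1 \<le> T (x, j)" using ss by (simp add: semistandard_def)
    moreover have "T (x, j) \<le> T c" using less[of x i] x c ij by (cases "x = i") auto
    ultimately show "Suc 0 \<le> T (x, j) \<and> T (x, j) \<le> T c" by simp
  qed
  ultimately have "card ?A \<le> card {1..T c}" by (rule card_inj_on_le) simp
  then show ?thesis using c ij by (simp add: column_rank_def)
qed

text \<open>The label 0, about which the content says nothing, does not occur on the shape.\<close>

lemma card_labels_le:
  assumes "semistandard \<gamma> lam T" "has_content \<gamma> lam T \<mu>"
  shows "card {c \<in> skew_cells \<gamma> lam. T c \<le> b} = (\<Sum>t = 1..b. part \<mu> t)"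
proof -
  have "{c \<in> skew_cells \<gamma> lam. T c \<le> b} = (\<Union>t\<in>{1..b}. {c \<in> skew_cells \<gamma> lam. T c = t})"
    using assms(1) by (auto simp: semistandard_def)
  also have "card \<dots> = (\<Sum>t = 1..b. card {c \<in> skew_cells \<gamma> lam. T c = t})"
    by (intro card_UN_disjoint) auto
  finally show ?thesis using assms(2) by (simp add: has_content_def)
qed

text \<open>By \<open>column_rank_le\<close> the cells with \<open>T\<close> at most
  \<open>b\<close> are among those of rank at most \<open>b\<close>. Equal contents make the two
  sets equally large, hence equal, and taking the rank of \<open>c\<close> as \<open>b\<close> gives
  the missing inequality at \<open>c\<close>.\<close>

lemma column_rank_unique:
  assumes sk: "is_skew_shape \<gamma> lam" and ss: "semistandard \<gamma> lam T"
    and hc: "has_content \<gamma> lam T (top_left_std \<gamma> lam)"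
  shows "T = column_rank \<gamma> lam"
proof
  fix c
  show "T c = column_rank \<gamma> lam c"
  proof (cases "c \<in> skew_cells \<gamma> lam")
    case True
    let ?b = "column_rank \<gamma> lam c"
    have "{c \<in> skew_cells \<gamma> lam. T c \<le> ?b} = {c' \<in> skew_cells \<gamma> lam. column_rank \<gamma> lam c' \<le> ?b}"
    proof (rule card_subset_eq)
      show "{c \<in> skew_cells \<gamma> lam. T c \<le> ?b} \<subseteq> {c' \<in> skew_cells \<gamma> lam. column_rank \<gamma> lam c' \<le> ?b}"
        using column_rank_le[OF ss] by (auto intro: order_trans)
    qed (simp_all add: card_labels_le[OF ss hc]
        card_labels_le[OF semistandard_column_rank[OF sk] has_content_column_rank])
    then have "T c \<le> ?b" using True by blast
    then show ?thesis using column_rank_le[OF ss True] by simp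
  next
    case False
    then have "T c = 0" using ss unfolding semistandard_def by blast
    with False show ?thesis by (simp add: column_rank_def)
  qed
qed

lemma lr_coeff_upper_deriv0:
  assumes "is_skew_shape \<gamma> lam"
  shows "lr_coeff \<gamma> lam (upper_deriv0 \<gamma> lam) = 1"
proof -
  have "lr_tableaux \<gamma> lam (top_left_std \<gamma> lam) = {column_rank \<gamma> lam}"
    unfolding lr_tableaux_def
    using semistandard_column_rank[OF assms] has_content_column_rank lattice_word_column_rank[OF assms]
    by (intro equalityI subsetI) (blast intro: column_rank_unique[OF assms], simp)
  then show ?thesis by (simp add: lr_coeff_def upper_deriv0_def)
qed

theorem theorem4p1:
  fixes \<gamma> lam :: "nat list" and n :: nat
  assumes "is_skew_shape \<gamma> lam" and "length \<gamma> = n"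
  shows "(\<forall>\<mu>. is_partition \<mu> \<and> lr_coeff \<gamma> lam \<mu> \<noteq> 0 \<longrightarrow>
            \<mu> \<le>\<^sub>G upper_deriv0 \<gamma> lam \<and>
            (\<forall>j is. 1 \<le> j \<and> j \<le> n \<and> length is = j \<and> sorted_wrt (<) is \<and> set is \<subseteq> {1..n} \<longrightarrow>
               drop j \<mu> \<le>\<^sub>G upper_deriv is \<gamma> lam)) \<and>
         lr_coeff \<gamma> lam (upper_deriv0 \<gamma> lam) = 1 \<and>
         (is_partition (upper_deriv0 \<gamma> lam) \<and> lr_coeff \<gamma> lam (upper_deriv0 \<gamma> lam) \<noteq> 0 \<and>
          (\<forall>\<mu>. is_partition \<mu> \<and> lr_coeff \<gamma> lam \<mu> \<noteq> 0 \<longrightarrow> \<mu> \<le>\<^sub>G upper_deriv0 \<gamma> lam))"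
proof -
  have "is_partition (upper_deriv0 \<gamma> lam)"
    by (simp add: upper_deriv0_def top_left_std_def is_partition_conj_partition sorted_column_sizes)
  \<comment> \<open>A strictly increasing sequence of rows is distinct, as the bound for deleted
    rows requires.\<close>
  then show ?thesis
    using lr_gdom_le_upper_deriv0[OF assms(1)] lr_gdom_le_upper_deriv[OF assms(1)]
      lr_coeff_upper_deriv0[OF assms(1)] assms(2)
    by (auto simp: strict_sorted_iff)
qed

end
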